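(* Let $\mathcal{A},\mathcal{B}$ be polarities and let $R\subseteq A^-\times B^+$ be a compatible relation from $\mathcal{A}$ to $\mathcal{B}$. Let $\mathrm{pol}(R)=(A^-,B^+;R)$ be the polarity with lower set $A^-$, upper set $B^+$ and incidence relation $R$. Then the relation $R$ is compatible as a relation from $\mathcal{A}$ to $\mathrm{pol}(R)$, and as such is an epimorphism $\mathcal{A}\to\mathrm{pol}(R)$ in $\mathbf{Pol}$; the relation $R$ is compatible as a relation from $\mathrm{pol}(R)$ to $\mathcal{B}$, and as such is a monomorphism $\mathrm{pol}(R)\to\mathcal{B}$ in $\mathbf{Pol}$; and the morphism $R:\mathcal{A}\to\mathcal{B}$ is the composite of these two, $R=R\mathbin{;}_{\mathrm{pol}(R)}R$ (composition through $\mathrm{pol}(R)$).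
   Context: For a binary relation $R\subseteq A\times B$ between sets, define antitone maps $R^{\downarrow}:\mathcal{P}(B)\to\mathcal{P}(A)$ and $R^{\uparrow}:\mathcal{P}(A)\to\mathcal{P}(B)$ by $R^{\downarrow}(Y)=\{a\in A\mid a\mathrel{R}\beta\text{ for all }\beta\in Y\}$ and $R^{\uparrow}(X)=\{\beta\in B\mid a\mathrel{R}\beta\text{ for all }a\in X\}$. Juxtaposition of such maps denotes composition, the rightmost map being applied first. A polarity $\mathcal{A}=(A^-,A^+;\mathcal{A})$ consists of two sets $A^-,A^+$ (its lower and upper sets) and a binary relation $\mathcal{A}\subseteq A^-\times A^+$ (its incidence relation, denoted by the same letter). Put $\mathrm{cl}_{\mathcal{A}}=\mathcal{A}^{\downarrow}\mathcal{A}^{\uparrow}$ on $\mathcal{P}(A^-)$ and $\mathrm{cl}^{\mathcal{A}}=\mathcal{A}^{\uparrow}\mathcal{A}^{\downarrow}$ on $\mathcal{P}(A^+)$. For polarities $\mathcal{A},\mathcal{B}$, a relation $R\subseteq A^-\times B^+$ is a compatible relation from $\mathcal{A}$ to $\mathcal{B}$ if $\mathrm{cl}_{\mathcal{A}}R^{\downarrow}=R^{\downarrow}$ and $R^{\downarrow}\mathrm{cl}^{\mathcal{B}}=R^{\downarrow}$. $\mathbf{Pol}$ is the category whose objects are polarities and whose morphisms $\mathcal{A}\to\mathcal{B}$ are the compatible relations from $\mathcal{A}$ to $\mathcal{B}$. The composite of $R:\mathcal{A}\to\mathcal{B}$ and $S:\mathcal{B}\to\mathcal{C}$ (written in diagrammatic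 order) is the relation $R\mathbin{;}_{\mathcal{B}}S\subseteq A^-\times C^+$ with $a\mathrel{(R\mathbin{;}_{\mathcal{B}}S)}\gamma$ if and only if $a\in R^{\downarrow}\mathcal{B}^{\uparrow}S^{\downarrow}(\{\gamma\})$. The identity on $\mathcal{A}$ is its incidence relation. *)

theory Defs
  imports Main
begin

(* For R <= A x B the maps between powersets depend on the ambient carriers
   (e.g. the image of the empty set is the whole carrier), so the carrier in which
   the result lives is an explicit argument. *)
definition down :: "'a set \<Rightarrow> ('a \<times> 'b) set \<Rightarrow> 'b set \<Rightarrow> 'a set" where
  "down A R Y = {a \<in> A. \<forall>\<beta>\<in>Y. (a, \<beta>) \<in> R}"

definition up :: "'b set \<Rightarrow> ('a \<times> 'b) set \<Rightarrow> 'a set \<Rightarrow> 'b set" where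
  "up B R X = {\<beta> \<in> B. \<forall>a\<in>X. (a, \<beta>) \<in> R}"

record ('a, 'b) polarity =
  lower :: "'a set"
  upper :: "'b set"
  incidence :: "('a \<times> 'b) set"

definition is_polarity :: "('a, 'b) polarity \<Rightarrow> bool" where
  "is_polarity A \<longleftrightarrow> incidence A \<subseteq> lower A \<times> upper A"

definition cl_lower :: "('a, 'b) polarity \<Rightarrow> 'a set \<Rightarrow> 'a set" where
  "cl_lower A X = down (lower A) (incidence A) (up (upper A) (incidence A) X)"

definition cl_upper :: "('a, 'b) polarity \<Rightarrow> 'b set \<Rightarrow> 'b set" where
  "cl_upper A Y = up (upper A) (incidence A) (down (lower A) (incidence A) Y)"

definition compatible :: "('a, 'b) polarity \<Rightarrow> ('c, 'd) polarity \<Rightarrow> ('a \<times> 'd) set \<Rightarrow> bool" where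
  "compatible A B R \<longleftrightarrow>
     R \<subseteq> lower A \<times> upper B \<and>
     (\<forall>Y \<subseteq> upper B. cl_lower A (down (lower A) R Y) = down (lower A) R Y) \<and>
     (\<forall>Y \<subseteq> upper B. down (lower A) R (cl_upper B Y) = down (lower A) R Y)"

definition Pol_hom :: "('a, 'b) polarity \<Rightarrow> ('c, 'd) polarity \<Rightarrow> ('a \<times> 'd) set set" where
  "Pol_hom A B = {R. is_polarity A \<and> is_polarity B \<and> compatible A B R}"

(* Composition in diagrammatic order of R : A -> B and S : B -> C, through B. *)
definition Pol_comp ::
  "('a, 'b) polarity \<Rightarrow> ('c, 'd) polarity \<Rightarrow> ('e, 'f) polarity \<Rightarrow>
   ('a \<times> 'd) set \<Rightarrow> ('c \<times> 'f) set \<Rightarrow> ('a \<times> 'f) set" where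
  "Pol_comp A B C R S =
     {(a, \<gamma>) \<in> lower A \<times> upper C.
        a \<in> down (lower A) R (up (upper B) (incidence B) (down (lower B) S {\<gamma>}))}"

(* Objects of Pol may live over any pair of types, and HOL cannot quantify over types
   inside a formula.  The first argument names the types over which the test object
   ranges; being an epimorphism (monomorphism) in Pol means that the predicate holds
   for all instances of these types, i.e. with 'e and 'f left as type variables
   in the conclusion of a theorem. *)
definition Pol_epi ::
  "('e, 'f) polarity itself \<Rightarrow> ('a, 'b) polarity \<Rightarrow> ('c, 'd) polarity \<Rightarrow> ('a \<times> 'd) set \<Rightarrow> bool" where
  "Pol_epi _ A B R \<longleftrightarrow>
     R \<in> Pol_hom A B \<and>
     (\<forall>C :: ('e, 'f) polarity. \<forall>S \<in> Pol_hom B C. \<forall>T \<in> Pol_hom B C.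
        Pol_comp A B C R S = Pol_comp A B C R T \<longrightarrow> S = T)"

definition Pol_mono ::
  "('e, 'f) polarity itself \<Rightarrow> ('a, 'b) polarity \<Rightarrow> ('c, 'd) polarity \<Rightarrow> ('a \<times> 'd) set \<Rightarrow> bool" where
  "Pol_mono _ A B R \<longleftrightarrow>
     R \<in> Pol_hom A B \<and>
     (\<forall>C :: ('e, 'f) polarity. \<forall>S \<in> Pol_hom C A. \<forall>T \<in> Pol_hom C A.
        Pol_comp C A B S R = Pol_comp C A B T R \<longrightarrow> S = T)"

definition pol :: "('a, 'b) polarity \<Rightarrow> ('c, 'd) polarity \<Rightarrow> ('a \<times> 'd) set \<Rightarrow> ('a, 'd) polarity" where
  "pol A B R = \<lparr>lower = lower A, upper = upper B, incidence = R\<rparr>"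

end

theory Submission
  imports Defs
begin

text \<open>
  The relation \<open>R\<close> is the identity morphism of \<open>pol(R)\<close>, and the composition formula looks at its
  outer polarities only through the lower set of the source and the upper set of the target. These
  carriers are shared by \<open>A\<close> and \<open>pol(R)\<close>, respectively by \<open>pol(R)\<close> and \<open>B\<close>. Therefore composing
  with \<open>R : A \<rightarrow> pol(R)\<close> or with \<open>R : pol(R) \<rightarrow> B\<close> is literally composing with an identity: it leaves
  the underlying relation unchanged (lemmas \<open>Pol_comp_incidence_left\<close> and
  \<open>Pol_comp_incidence_right\<close>). Cancellability and the factorisation of \<open>R\<close> are immediate.

  Compatibility of the two factors is half inherited from \<open>R : A \<rightarrow> B\<close> and half the law of Galois
  connections \<open>R\<^sup>\<down> R\<^sup>\<up> R\<^sup>\<down> = R\<^sup>\<down>\<close> (lemma \<open>down_up_down\<close>), read once as closedness of the values of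
  \<open>R\<^sup>\<down>\<close> and once as invariance of \<open>R\<^sup>\<down>\<close> under closing its argument.
\<close>

lemma down_up_down:
  assumes "Y \<subseteq> B"
  shows "down A R (up B R (down A R Y)) = down A R Y"
  using assms by (fastforce simp: down_def up_def)

lemma compatible_to_pol:
  assumes "compatible A B R"
  shows "compatible A (pol A B R) R"
  using assms by (simp add: compatible_def pol_def cl_upper_def down_up_down)

lemma compatible_from_pol:
  assumes "compatible A B R"
  shows "compatible (pol A B R) B R"
  using assms by (simp add: compatible_def pol_def cl_lower_def down_up_down)

text \<open>
  The elements related to \<open>\<gamma>\<close> by the composite form the closure in \<open>A\<close> of \<open>S\<^sup>\<down>{\<gamma>}\<close>, which is closed
  by compatibility. For \<open>A' = A\<close> this is the left identity law of \<open>Pol\<close>; a source \<open>A'\<close> with other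
  upper set and incidence is permitted so that the law covers precomposition with
  \<open>R : A' \<rightarrow> pol(R)\<close>, taking \<open>pol(R)\<close> for \<open>A\<close>.
\<close>
lemma Pol_comp_incidence_left:
  assumes "compatible A C S" and "lower A' = lower A"
  shows "Pol_comp A' A C (incidence A) S = S"
proof -
  have S: "S \<subseteq> lower A \<times> upper C"
    using assms(1) by (simp add: compatible_def)
  have closed: "cl_lower A (down (lower A) S {\<gamma>}) = down (lower A) S {\<gamma>}" if "\<gamma> \<in> upper C" for \<gamma>
    using assms(1) that by (simp add: compatible_def)
  have "Pol_comp A' A C (incidence A) S =
      {(a, \<gamma>) \<in> lower A \<times> upper C. a \<in> cl_lower A (down (lower A) S {\<gamma>})}"
    by (simp add: Pol_comp_def cl_lower_def assms(2))
  also have "\<dots> = {(a, \<gamma>) \<in> lower A \<times> upper C. a \<in> down (lower A) S {\<gamma>}}"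
    using closed by auto
  also have "\<dots> = S"
    using S by (auto simp: down_def)
  finally show ?thesis .
qed

text \<open>
  Dually, the elements related to \<open>\<gamma>\<close> by the composite form \<open>S\<^sup>\<down>\<close> of the closure of \<open>{\<gamma>}\<close> in \<open>B\<close>,
  and compatibility of \<open>S\<close> lets the closure be dropped. The target \<open>B'\<close> is left free for
  postcomposition with \<open>R : pol(R) \<rightarrow> B'\<close>, taking \<open>pol(R)\<close> for \<open>B\<close>.
\<close>
lemma Pol_comp_incidence_right:
  assumes "compatible C B S" and "upper B' = upper B"
  shows "Pol_comp C B B' S (incidence B) = S"
proof -
  have S: "S \<subseteq> lower C \<times> upper B"
    using assms(1) by (simp add: compatible_def)
  have closed: "down (lower C) S (cl_upper B {\<gamma>}) = down (lower C) S {\<gamma>}" if "\<gamma> \<in> upper B" for \<gamma>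
    using assms(1) that by (simp add: compatible_def)
  have "Pol_comp C B B' S (incidence B) =
      {(c, \<gamma>) \<in> lower C \<times> upper B. c \<in> down (lower C) S (cl_upper B {\<gamma>})}"
    by (simp add: Pol_comp_def cl_upper_def assms(2))
  also have "\<dots> = {(c, \<gamma>) \<in> lower C \<times> upper B. c \<in> down (lower C) S {\<gamma>}}"
    using closed by auto
  also have "\<dots> = S"
    using S by (auto simp: down_def)
  finally show ?thesis .
qed

theorem mainTheorem4:
  fixes A :: "('a, 'b) polarity" and B :: "('c, 'd) polarity" and R :: "('a \<times> 'd) set"
  assumes "is_polarity A" and "is_polarity B" and "compatible A B R"
  shows "compatible A (pol A B R) R \<and> Pol_epi TYPE(('e, 'f) polarity) A (pol A B R) R \<and>
         compatible (pol A B R) B R \<and> Pol_mono TYPE(('e, 'f) polarity) (pol A B R) B R \<and>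
         R = Pol_comp A (pol A B R) B R R"
proof -
  let ?P = "pol A B R"
  have P: "lower ?P = lower A" "upper ?P = upper B" "incidence ?P = R"
    by (simp_all add: pol_def)
  have "is_polarity ?P"
    using assms(3) by (simp add: is_polarity_def compatible_def P)
  then have hom: "R \<in> Pol_hom A ?P" "R \<in> Pol_hom ?P B"
    using assms compatible_to_pol compatible_from_pol by (simp_all add: Pol_hom_def)
  have left: "Pol_comp A ?P C R S = S" if "compatible ?P C S"
    for C :: "('e, 'f) polarity" and S
    using Pol_comp_incidence_left[OF that, of A] by (simp add: P)
  have right: "Pol_comp C ?P B S R = S" if "compatible C ?P S"
    for C :: "('e, 'f) polarity" and S
    using Pol_comp_incidence_right[OF that, of B] by (simp add: P)
  have "Pol_epi TYPE(('e, 'f) polarity) A ?P R"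
    using hom(1) left by (auto simp: Pol_epi_def Pol_hom_def)
  moreover have "Pol_mono TYPE(('e, 'f) polarity) ?P B R"
    using hom(2) right by (auto simp: Pol_mono_def Pol_hom_def)
  moreover have "R = Pol_comp A ?P B R R"
    using Pol_comp_incidence_left[OF compatible_from_pol[OF assms(3)], of A] by (simp add: P)
  ultimately show ?thesis
    using hom by (simp add: Pol_hom_def)
qed

end
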